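(* Let $G_1,G_2$ be residually finite groups with $\widehat{G_1}\cong\widehat{G_2}$. Then $G_1$ is uniformly amenable if and only if $G_2$ is uniformly amenable.
   Context: The profinite completion of a group $G$ is the profinite group $\widehat{G}=\varprojlim_N G/N$, $N$ ranging over the finite index normal subgroups of $G$; isomorphism of profinite completions means isomorphism of profinite (topological) groups. A class of groups $\mathfrak{K}$ is uniformly amenable if there is a function $m\colon\mathbb{R}_{>0}\times\mathbb{N}_0\to\mathbb{N}$ such that for every $\epsilon>0$, every $G\in\mathfrak{K}$ and every finite subset $S\subseteq G$ there is a non-empty finite set $F\subseteq G$ with $|F|\le m(\epsilon,|S|)$ and $|SF|\le(1+\epsilon)|F|$. A group $G$ is uniformly amenable if the class $\{G\}$ is. *)

theory Defs
  imports "HOL-Analysis.Analysis" "HOL-Algebra.Product_Groups"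
begin

definition finite_index_normal :: "('a, 'm) monoid_scheme \<Rightarrow> 'a set set" where
  "finite_index_normal G = {N. N \<lhd> G \<and> finite (rcosets\<^bsub>G\<^esub> N)}"

definition residually_finite :: "('a, 'm) monoid_scheme \<Rightarrow> bool" where
  "residually_finite G \<longleftrightarrow>
     (\<forall>g \<in> carrier G. g \<noteq> \<one>\<^bsub>G\<^esub> \<longrightarrow> (\<exists>N \<in> finite_index_normal G. g \<notin> N))"

text \<open>
  The inverse limit of the finite quotients of \<open>G\<close>, realised inside their product. An element
  of the product is a family \<open>x\<close> with \<open>x N\<close> a coset of \<open>N\<close>. For \<open>N \<subseteq> M\<close> the transition
  homomorphism from \<open>G Mod N\<close> to \<open>G Mod M\<close> sends the coset \<open>N g\<close> to \<open>M g = M (N g)\<close>, that is,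
  it maps \<open>C\<close> to the product set \<open>M <#>\<^bsub>G\<^esub> C\<close>.
\<close>

definition profinite_completion_set :: "('a, 'm) monoid_scheme \<Rightarrow> ('a set \<Rightarrow> 'a set) set" where
  "profinite_completion_set G =
     {x \<in> (\<Pi>\<^sub>E N \<in> finite_index_normal G. carrier (G Mod N)).
        \<forall>N \<in> finite_index_normal G. \<forall>M \<in> finite_index_normal G.
          N \<subseteq> M \<longrightarrow> x M = M <#>\<^bsub>G\<^esub> x N}"

definition profinite_completion :: "('a, 'm) monoid_scheme \<Rightarrow> ('a set \<Rightarrow> 'a set) monoid" where
  "profinite_completion G =
     (product_group (finite_index_normal G) (\<lambda>N. G Mod N))
       \<lparr>carrier := profinite_completion_set G\<rparr>"

definition profinite_completion_topology ::
    "('a, 'm) monoid_scheme \<Rightarrow> ('a set \<Rightarrow> 'a set) topology" where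
  "profinite_completion_topology G =
     subtopology
       (product_topology (\<lambda>N. discrete_topology (carrier (G Mod N))) (finite_index_normal G))
       (profinite_completion_set G)"

definition isomorphic_profinite_completions ::
    "('a, 'm) monoid_scheme \<Rightarrow> ('b, 'n) monoid_scheme \<Rightarrow> bool" where
  "isomorphic_profinite_completions G H \<longleftrightarrow>
     (\<exists>h \<in> iso (profinite_completion G) (profinite_completion H).
        homeomorphic_map (profinite_completion_topology G) (profinite_completion_topology H) h)"

definition uniformly_amenable_class :: "('a, 'm) monoid_scheme set \<Rightarrow> bool" where
  "uniformly_amenable_class K \<longleftrightarrow>
     (\<exists>m :: real \<Rightarrow> nat \<Rightarrow> nat.
        \<forall>\<epsilon>>0. \<forall>G \<in> K. \<forall>S. finite S \<and> S \<subseteq> carrier G \<longrightarrow>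
          (\<exists>F. F \<noteq> {} \<and> finite F \<and> F \<subseteq> carrier G \<and> card F \<le> m \<epsilon> (card S) \<and>
               real (card (S <#>\<^bsub>G\<^esub> F)) \<le> (1 + \<epsilon>) * real (card F)))"

definition uniformly_amenable :: "('a, 'm) monoid_scheme \<Rightarrow> bool" where
  "uniformly_amenable G \<longleftrightarrow> uniformly_amenable_class {G}"

lemma (in group) transition_map_rcoset:
  assumes "subgroup N G" "subgroup M G" "N \<subseteq> M" "g \<in> carrier G"
  shows "M <#> (N #> g) = M #> g"
proof -
  have MN: "M <#> N = M"
  proof
    show "M <#> N \<subseteq> M"
      using assms(3) subgroup.m_closed[OF assms(2)] by (auto simp: set_mult_def)
    show "M \<subseteq> M <#> N"
    proof
      fix x assume x: "x \<in> M"
      then have "x = x \<otimes> \<one>"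
        using subgroup.mem_carrier[OF assms(2)] by simp
      then show "x \<in> M <#> N"
        using x subgroup.one_closed[OF assms(1)] by (auto simp: set_mult_def)
    qed
  qed
  show ?thesis
    using setmult_rcos_assoc[of M N g] MN assms(4)
      subgroup.subset[OF assms(1)] subgroup.subset[OF assms(2)] by simp
qed

lemma (in group) group_profinite_completion: "group (profinite_completion G)"
proof -
  let ?I = "finite_index_normal G"
  let ?P = "product_group ?I (\<lambda>N. G Mod N)"
  have nrm: "N \<lhd> G" if "N \<in> ?I" for N
    using that by (simp add: finite_index_normal_def)
  have sub: "subgroup N G" if "N \<in> ?I" for N
    using nrm[OF that] by (rule normal_imp_subgroup)
  have grp: "group (G Mod N)" if "N \<in> ?I" for N
    using nrm[OF that] by (rule normal.factorgroup_is_group)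
  interpret P: group ?P
    by (rule product_group) (rule grp)
  have hom: "group_hom (G Mod N) (G Mod M) (\<lambda>C. M <#> C)"
    if N: "N \<in> ?I" and M: "M \<in> ?I" and NM: "N \<subseteq> M" for N M
  proof -
    have "(\<lambda>C. M <#> C) \<in> hom (G Mod N) (G Mod M)"
      by (rule homI)
        (auto simp: carrier_FactGroup transition_map_rcoset[OF sub[OF N] sub[OF M] NM]
          normal.rcos_sum[OF nrm[OF N]] normal.rcos_sum[OF nrm[OF M]])
    then show ?thesis
      using grp[OF N] grp[OF M] by (simp add: group_hom_def group_hom_axioms_def)
  qed
  have "subgroup (profinite_completion_set G) ?P"
  proof (rule P.subgroupI)
    show "profinite_completion_set G \<subseteq> carrier ?P"
      by (auto simp: profinite_completion_set_def)
    have "\<one>\<^bsub>?P\<^esub> \<in> profinite_completion_set G"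
      using P.one_closed group_hom.hom_one[OF hom]
      by (simp add: profinite_completion_set_def)
    then show "profinite_completion_set G \<noteq> {}" by blast
  next
    fix x assume x: "x \<in> profinite_completion_set G"
    then have xc: "x \<in> (\<Pi>\<^sub>E N \<in> ?I. carrier (G Mod N))"
      and xt: "\<And>N M. N \<in> ?I \<Longrightarrow> M \<in> ?I \<Longrightarrow> N \<subseteq> M \<Longrightarrow> x M = M <#> x N"
      unfolding profinite_completion_set_def by blast+
    have inv: "inv\<^bsub>?P\<^esub> x = (\<lambda>N\<in>?I. inv\<^bsub>G Mod N\<^esub> x N)"
      using xc grp by (rule inv_product_group)
    have "inv\<^bsub>?P\<^esub> x \<in> (\<Pi>\<^sub>E N \<in> ?I. carrier (G Mod N))"
      using P.inv_closed xc by simp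
    moreover have "(inv\<^bsub>?P\<^esub> x) M = M <#> (inv\<^bsub>?P\<^esub> x) N"
      if N: "N \<in> ?I" and M: "M \<in> ?I" and NM: "N \<subseteq> M" for N M
      using group_hom.hom_inv[OF hom[OF N M NM] PiE_mem[OF xc N]] xt[OF N M NM]
      by (simp add: inv N M)
    ultimately show "inv\<^bsub>?P\<^esub> x \<in> profinite_completion_set G"
      unfolding profinite_completion_set_def by blast
    fix y assume y: "y \<in> profinite_completion_set G"
    then have yc: "y \<in> (\<Pi>\<^sub>E N \<in> ?I. carrier (G Mod N))"
      and yt: "\<And>N M. N \<in> ?I \<Longrightarrow> M \<in> ?I \<Longrightarrow> N \<subseteq> M \<Longrightarrow> y M = M <#> y N"
      unfolding profinite_completion_set_def by blast+
    have "x \<otimes>\<^bsub>?P\<^esub> y \<in> (\<Pi>\<^sub>E N \<in> ?I. carrier (G Mod N))"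
      using P.m_closed[of x y] xc yc by simp
    moreover have "(x \<otimes>\<^bsub>?P\<^esub> y) M = M <#> (x \<otimes>\<^bsub>?P\<^esub> y) N"
      if N: "N \<in> ?I" and M: "M \<in> ?I" and NM: "N \<subseteq> M" for N M
      using group_hom.hom_mult[OF hom[OF N M NM] PiE_mem[OF xc N] PiE_mem[OF yc N]]
        xt[OF N M NM] yt[OF N M NM]
      by (simp add: N M)
    ultimately show "x \<otimes>\<^bsub>?P\<^esub> y \<in> profinite_completion_set G"
      unfolding profinite_completion_set_def by blast
  qed
  then show ?thesis
    unfolding profinite_completion_def by (rule subgroup.subgroup_is_group) (rule P.is_group)
qed

lemma topspace_profinite_completion_topology:
  "topspace (profinite_completion_topology G) = carrier (profinite_completion G)"
  by (auto simp: profinite_completion_topology_def profinite_completion_def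
      profinite_completion_set_def)

end

theory Submission
  imports Defs
begin

text \<open>
  Write \<open>n\<close> for the bound \<open>m \<epsilon> (card S)\<close>, and call a set as in the definition of uniform amenability
  a Folner set for \<open>S\<close> of size at most \<open>n\<close>. Uniform amenability passes from a group \<open>G\<close> to a
  residually finite group \<open>H\<close> with the same profinite completion, with the same function \<open>m\<close>, because
  the size bound makes it a statement about finite quotients.

  Let \<open>S\<close> be a finite subset of \<open>H\<close>. Every finite quotient \<open>Q\<close> of \<open>H\<close> is also a quotient of \<open>G\<close>
  (\<open>surjective_hom_to_finite_quotient\<close>): it is a continuous quotient of the common completion, in which
  the image of \<open>G\<close> is dense, and \<open>Q\<close> is discrete. If \<open>S\<close> embeds in \<open>Q\<close>, its image lifts to a subset of
  \<open>G\<close> of the same size. This subset has a Folner set of size at most \<open>n\<close>, and Folner sets can be pushed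
  forward along homomorphisms (\<open>bounded_Folner_set_image\<close>): among the level sets of the function that
  counts the points in the fibers there is one that does at least as well as the average.
  So the image of \<open>S\<close> in \<open>Q\<close> has a Folner set of size at most \<open>n\<close>.

  To return to \<open>H\<close>, take in \<open>Q\<close> a Folner set of least size. It is connected, as otherwise one of two
  separate parts would be a smaller Folner set. Having at most \<open>n\<close> elements, it is contained in a right
  translate of a ball of radius \<open>n\<close> (\<open>minimal_Folner_set_subset_ball\<close>). The ball depends on \<open>S\<close> and \<open>n\<close>
  only, so by residual finiteness \<open>Q\<close> can be chosen beforehand such that the ball, and its product with
  \<open>S\<close>, embed in \<open>Q\<close>. The Folner set then lifts to \<open>H\<close> (\<open>bounded_Folner_set_lift\<close>).
\<close>

section \<open>Bounded Folner sets\<close>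

definition bounded_Folner_set ::
    "('a, 'm) monoid_scheme \<Rightarrow> 'a set \<Rightarrow> real \<Rightarrow> nat \<Rightarrow> 'a set \<Rightarrow> bool" where
  "bounded_Folner_set G S \<epsilon> n F \<longleftrightarrow>
     F \<noteq> {} \<and> finite F \<and> F \<subseteq> carrier G \<and> card F \<le> n \<and>
     real (card (S <#>\<^bsub>G\<^esub> F)) \<le> (1 + \<epsilon>) * real (card F)"

lemma uniformly_amenable_iff:
  "uniformly_amenable G \<longleftrightarrow>
     (\<exists>m. \<forall>\<epsilon>>0. \<forall>S. finite S \<and> S \<subseteq> carrier G \<longrightarrow>
        (\<exists>F. bounded_Folner_set G S \<epsilon> (m \<epsilon> (card S)) F))"
  unfolding uniformly_amenable_def uniformly_amenable_class_def bounded_Folner_set_def by simp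

lemma finite_set_mult: "finite S \<Longrightarrow> finite F \<Longrightarrow> finite (S <#>\<^bsub>G\<^esub> F)"
  unfolding set_mult_def by auto

section \<open>Images of Folner sets under homomorphisms\<close>

definition fiber_level :: "('a \<Rightarrow> 'b) \<Rightarrow> 'a set \<Rightarrow> nat \<Rightarrow> 'b set" where
  "fiber_level f A k = {y \<in> f ` A. k \<le> card {x \<in> A. f x = y}}"

text \<open>
  The layer-cake formula for the function that counts the points of \<open>A\<close> in each fiber of \<open>f\<close>.
  Any sufficiently large \<open>K\<close> is admitted so that the formulas for two sets can be compared term by term.
\<close>

lemma card_eq_sum_fiber_levels:
  assumes "finite A" "card A \<le> K"
  shows "card A = (\<Sum>k=1..K. card (fiber_level f A k))"
proof -
  let ?c = "\<lambda>y. card {x \<in> A. f x = y}"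
  have "card A = (\<Sum>x\<in>A. 1)" by simp
  also have "\<dots> = (\<Sum>y\<in>f ` A. ?c y)"
    using sum.image_gen[OF assms(1), of "\<lambda>_. 1::nat" f] by simp
  also have "\<dots> = (\<Sum>y\<in>f ` A. \<Sum>k=1..K. if k \<le> ?c y then 1 else 0)"
  proof (rule sum.cong[OF refl])
    fix y assume "y \<in> f ` A"
    have "?c y \<le> card A" using assms by (auto intro: card_mono)
    then have "{k \<in> {1..K}. k \<le> ?c y} = {1..?c y}" using assms by auto
    then show "?c y = (\<Sum>k=1..K. if k \<le> ?c y then 1 else 0)"
      by (simp flip: sum.inter_filter)
  qed
  also have "\<dots> = (\<Sum>k=1..K. \<Sum>y\<in>f ` A. if k \<le> ?c y then 1 else 0)"
    by (rule sum.swap)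
  also have "\<dots> = (\<Sum>k=1..K. card (fiber_level f A k))"
    using assms by (simp add: fiber_level_def flip: sum.inter_filter)
  finally show ?thesis .
qed

text \<open>
  Left translation by \<open>s\<close> embeds the part of \<open>F\<close> over \<open>z\<close> into the part of \<open>S <#> F\<close> over \<open>h s \<otimes>\<^bsub>H\<^esub> z\<close>,
  so the fibers do not shrink.
\<close>

lemma (in group_hom) set_mult_fiber_level_subset:
  assumes "finite S" "S \<subseteq> carrier G" "finite F" "F \<subseteq> carrier G"
  shows "(h ` S) <#>\<^bsub>H\<^esub> fiber_level h F k \<subseteq> fiber_level h (S <#> F) k"
proof
  fix y assume "y \<in> (h ` S) <#>\<^bsub>H\<^esub> fiber_level h F k"
  then obtain s z where s: "s \<in> S" and z: "z \<in> fiber_level h F k" and y: "y = h s \<otimes>\<^bsub>H\<^esub> z"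
    unfolding set_mult_def by auto
  have sG: "s \<in> carrier G" using s assms by auto
  let ?Z = "{x \<in> F. h x = z}"
  have ZG: "x \<in> carrier G" if "x \<in> ?Z" for x using that assms(4) by blast
  have sub: "(\<lambda>x. s \<otimes> x) ` ?Z \<subseteq> {x \<in> S <#> F. h x = y}"
  proof clarify
    fix x assume "x \<in> F" "z = h x"
    then show "s \<otimes> x \<in> S <#> F \<and> h (s \<otimes> x) = y"
      using s sG y ZG[of x] by (auto simp: set_mult_def)
  qed
  have "inj_on (\<lambda>x. s \<otimes> x) ?Z"
    using sG ZG by (intro inj_onI) simp
  then have "card ?Z \<le> card {x \<in> S <#> F. h x = y}"
    using card_mono[OF _ sub] finite_set_mult[OF assms(1,3), of G] by (simp add: card_image)
  moreover have "?Z \<noteq> {}" "k \<le> card ?Z" using z by (auto simp: fiber_level_def)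
  ultimately show "y \<in> fiber_level h (S <#> F) k"
    using sub by (auto simp: fiber_level_def)
qed

text \<open>
  The image of a Folner set need not be a Folner set, since \<open>h\<close> may collapse \<open>F\<close> much more than \<open>S <#> F\<close>.
  One of the sets \<open>fiber_level h F k\<close> works: if all the nonempty ones failed, summing over \<open>k\<close> and
  applying the two preceding lemmas would give \<open>(1 + \<epsilon>) * card F < card (S <#> F)\<close>.
\<close>

lemma (in group_hom) bounded_Folner_set_image:
  assumes S: "finite S" "S \<subseteq> carrier G" and F: "bounded_Folner_set G S \<epsilon> n F"
  obtains F' where "bounded_Folner_set H (h ` S) \<epsilon> n F'"
proof -
  have finF: "finite F" and FG: "F \<subseteq> carrier G" and ne: "F \<noteq> {}" and n: "card F \<le> n"
    and fol: "real (card (S <#> F)) \<le> (1 + \<epsilon>) * real (card F)"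
    using F by (auto simp: bounded_Folner_set_def)
  have finSF: "finite (S <#> F)" using S finF by (simp add: finite_set_mult)
  define K where "K = card F + card (S <#> F)"
  let ?F = "fiber_level h F" and ?SF = "fiber_level h (S <#> F)"
  have sumF: "card F = (\<Sum>k=1..K. card (?F k))"
    by (rule card_eq_sum_fiber_levels[OF finF]) (simp add: K_def)
  have sumSF: "card (S <#> F) = (\<Sum>k=1..K. card (?SF k))"
    by (rule card_eq_sum_fiber_levels[OF finSF]) (simp add: K_def)
  have "\<exists>k\<in>{1..K}. ?F k \<noteq> {} \<and>
          real (card ((h ` S) <#>\<^bsub>H\<^esub> ?F k)) \<le> (1 + \<epsilon>) * real (card (?F k))"
  proof (rule ccontr)
    assume asm: "\<not> ?thesis"
    have neg: "(1 + \<epsilon>) * real (card (?F k)) < real (card ((h ` S) <#>\<^bsub>H\<^esub> ?F k))"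
      if "k \<in> {1..K}" "?F k \<noteq> {}" for k
      using asm that by (meson not_le)
    have le: "card ((h ` S) <#>\<^bsub>H\<^esub> ?F k) \<le> card (?SF k)" for k
      by (rule card_mono[OF _ set_mult_fiber_level_subset[OF S finF FG]])
        (use finSF in \<open>simp add: fiber_level_def\<close>)
    have strict: "(1 + \<epsilon>) * real (card (?F k)) < real (card (?SF k))"
      if "k \<in> {1..K}" "?F k \<noteq> {}" for k
      using neg[OF that] le[of k] by linarith
    \<comment> \<open>The level \<open>1\<close> is all of \<open>h ` F\<close>; this makes the inequality between the sums strict.\<close>
    have 1: "1 \<in> {1..K}" "?F 1 \<noteq> {}"
    proof -
      have "card F \<noteq> 0" using finF ne by simp
      then show "1 \<in> {1..K}" by (simp add: K_def)
      obtain x where x: "x \<in> F" using ne by blast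
      have "card {z \<in> F. h z = h x} \<noteq> 0"
        using finF x by auto
      then have "h x \<in> ?F 1" using x by (auto simp: fiber_level_def)
      then show "?F 1 \<noteq> {}" by blast
    qed
    have "(1 + \<epsilon>) * real (card F) = (\<Sum>k=1..K. (1 + \<epsilon>) * real (card (?F k)))"
      unfolding sumF of_nat_sum sum_distrib_left ..
    also have "\<dots> < (\<Sum>k=1..K. real (card (?SF k)))"
    proof (rule sum_strict_mono_ex1)
      show "\<forall>k\<in>{1..K}. (1 + \<epsilon>) * real (card (?F k)) \<le> real (card (?SF k))"
      proof
        fix k assume "k \<in> {1..K}"
        then show "(1 + \<epsilon>) * real (card (?F k)) \<le> real (card (?SF k))"
          using strict[of k] by (cases "?F k = {}") auto
      qed
      show "\<exists>k\<in>{1..K}. (1 + \<epsilon>) * real (card (?F k)) < real (card (?SF k))"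
        using strict[OF 1] 1(1) by (rule bexI)
    qed simp
    also have "\<dots> = real (card (S <#> F))"
      unfolding sumSF of_nat_sum ..
    finally show False using fol by linarith
  qed
  then obtain k where k: "?F k \<noteq> {}"
    "real (card ((h ` S) <#>\<^bsub>H\<^esub> ?F k)) \<le> (1 + \<epsilon>) * real (card (?F k))" by blast
  have sub: "?F k \<subseteq> h ` F" by (auto simp: fiber_level_def)
  have "bounded_Folner_set H (h ` S) \<epsilon> n (?F k)"
    unfolding bounded_Folner_set_def
  proof (intro conjI)
    show "finite (?F k)" using finite_subset[OF sub] finF by simp
    show "?F k \<subseteq> carrier H"
    proof
      fix y assume "y \<in> ?F k"
      then obtain x where "x \<in> F" "y = h x" using sub by auto
      then show "y \<in> carrier H" using FG by (simp add: subset_iff)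
    qed
    have "card (?F k) \<le> card (h ` F)" using card_mono[OF _ sub] finF by simp
    also have "\<dots> \<le> n" using card_image_le[OF finF, of h] n by simp
    finally show "card (?F k) \<le> n" .
  qed (fact k)+
  then show ?thesis by (rule that)
qed

section \<open>Minimal Folner sets and their lifts\<close>

text \<open>
  If \<open>S\<close> moves \<open>A\<close> and \<open>B\<close> to disjoint sets, then both sides of the Folner inequality are additive over
  \<open>A\<close> and \<open>B\<close>.
\<close>

lemma Folner_set_split:
  assumes "finite F" "F = A \<union> B" "A \<inter> B = {}"
    and "(S <#>\<^bsub>G\<^esub> A) \<inter> (S <#>\<^bsub>G\<^esub> B) = {}" "finite S"
    and "real (card (S <#>\<^bsub>G\<^esub> F)) \<le> (1 + \<epsilon>) * real (card F)"
  shows "real (card (S <#>\<^bsub>G\<^esub> A)) \<le> (1 + \<epsilon>) * real (card A) \<or>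
         real (card (S <#>\<^bsub>G\<^esub> B)) \<le> (1 + \<epsilon>) * real (card B)"
proof -
  have fin: "finite A" "finite B" using assms by auto
  have "S <#>\<^bsub>G\<^esub> F = (S <#>\<^bsub>G\<^esub> A) \<union> (S <#>\<^bsub>G\<^esub> B)"
    using assms(2) by (auto simp: set_mult_def)
  then have "card (S <#>\<^bsub>G\<^esub> F) = card (S <#>\<^bsub>G\<^esub> A) + card (S <#>\<^bsub>G\<^esub> B)"
    using fin assms by (simp add: card_Un_disjoint finite_set_mult)
  moreover have "card F = card A + card B"
    using fin assms by (simp add: card_Un_disjoint)
  ultimately show ?thesis using assms(6) by (auto simp: algebra_simps)
qed

text \<open>
  The ball of radius \<open>k\<close> about the identity for the generators \<open>inv s \<otimes> t\<close>, not for \<open>S\<close> itself: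
  \<open>y\<close> is reached from \<open>a\<close> in one step exactly when the translates \<open>S a\<close> and \<open>S y\<close> meet.
\<close>

primrec word_ball :: "('a, 'm) monoid_scheme \<Rightarrow> 'a set \<Rightarrow> nat \<Rightarrow> 'a set" where
  "word_ball G S 0 = {\<one>\<^bsub>G\<^esub>}"
| "word_ball G S (Suc k) =
     word_ball G S k \<union>
     (\<lambda>(s, t, b). inv\<^bsub>G\<^esub> s \<otimes>\<^bsub>G\<^esub> t \<otimes>\<^bsub>G\<^esub> b) ` (S \<times> S \<times> word_ball G S k)"

lemma finite_word_ball: "finite S \<Longrightarrow> finite (word_ball G S k)"
  by (induction k) auto

lemma (in group) word_ball_subset: "S \<subseteq> carrier G \<Longrightarrow> word_ball G S k \<subseteq> carrier G"
  by (induction k) (auto simp: subset_iff)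

text \<open>
  The part of \<open>F\<close> within distance \<open>k\<close> of \<open>x\<close> grows strictly with \<open>k\<close> until it is all of \<open>F\<close>: when it
  stops growing, it is separated from its complement in \<open>F\<close>, and one of the two would be a smaller Folner set.
  As \<open>F\<close> has at most \<open>n\<close> elements, this happens by \<open>k = n\<close>.
\<close>

lemma (in group) minimal_Folner_set_subset_ball:
  assumes S: "finite S" "S \<subseteq> carrier G"
    and F: "bounded_Folner_set G S \<epsilon> n F"
    and min: "\<And>F'. bounded_Folner_set G S \<epsilon> n F' \<Longrightarrow> card F \<le> card F'"
    and x: "x \<in> F"
  shows "F \<subseteq> word_ball G S n #> x"
proof -
  have finF: "finite F" and FG: "F \<subseteq> carrier G" and n: "card F \<le> n"
    and fol: "real (card (S <#> F)) \<le> (1 + \<epsilon>) * real (card F)"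
    using F by (auto simp: bounded_Folner_set_def)
  have xG: "x \<in> carrier G" using x FG by auto
  define A where "A k = F \<inter> (word_ball G S k #> x)" for k
  have xA: "x \<in> A k" for k
  proof -
    have "\<one> \<in> word_ball G S k" by (induction k) auto
    then show ?thesis using x xG by (force simp: A_def r_coset_def)
  qed
  have step: "A k \<subset> A (Suc k)" if "A k \<noteq> F" for k
  proof -
    have "(S <#> A k) \<inter> (S <#> (F - A k)) \<noteq> {}"
    proof
      assume "(S <#> A k) \<inter> (S <#> (F - A k)) = {}"
      then have "real (card (S <#> A k)) \<le> (1 + \<epsilon>) * real (card (A k)) \<or>
          real (card (S <#> (F - A k))) \<le> (1 + \<epsilon>) * real (card (F - A k))"
        by (intro Folner_set_split[OF finF _ _ _ S(1) fol]) (auto simp: A_def)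
      then obtain F' where F': "F' = A k \<or> F' = F - A k"
        and fol': "real (card (S <#> F')) \<le> (1 + \<epsilon>) * real (card F')" by blast
      have psub: "F' \<subset> F" "F' \<noteq> {}"
        using F' that xA[of k] x by (auto simp: A_def)
      then have less: "card F' < card F" using finF by (simp add: psubset_card_mono)
      then have "bounded_Folner_set G S \<epsilon> n F'"
        using psub fol' finF FG n unfolding bounded_Folner_set_def
        by (auto intro: finite_subset)
      then show False using min less by fastforce
    qed
    then obtain s t a y where st: "s \<in> S" "t \<in> S" and a: "a \<in> A k" and y: "y \<in> F - A k"
      and eq: "s \<otimes> a = t \<otimes> y"
      unfolding set_mult_def by auto
    obtain b where b: "b \<in> word_ball G S k" and ab: "a = b \<otimes> x"
      using a by (auto simp: A_def r_coset_def)
    have carr: "s \<in> carrier G" "t \<in> carrier G" "y \<in> carrier G" "b \<in> carrier G"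
      using st S y FG b word_ball_subset[OF S(2), of k] by auto
    have "y = inv t \<otimes> (s \<otimes> a)"
      using carr eq by (simp add: inv_solve_left m_assoc[symmetric])
    then have "y = (inv t \<otimes> s \<otimes> b) \<otimes> x"
      using carr xG ab by (simp add: m_assoc)
    moreover have "inv t \<otimes> s \<otimes> b \<in> word_ball G S (Suc k)"
      using st b by force
    ultimately have "y \<in> A (Suc k)" using y unfolding A_def r_coset_def by blast
    moreover have "A k \<subseteq> A (Suc k)" by (auto simp: A_def r_coset_def)
    ultimately show ?thesis using y by blast
  qed
  have grow: "A k = F \<or> k < card (A k)" for k
  proof (induction k)
    case 0
    have "finite (A 0)" using finF by (simp add: A_def)
    then show ?case using xA[of 0] by (auto simp: card_gt_0_iff)
  next
    case (Suc k)
    show ?case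
    proof (cases "A k = F")
      case True
      then have "A (Suc k) = F" by (auto simp: A_def r_coset_def)
      then show ?thesis ..
    next
      case False
      then have "card (A k) < card (A (Suc k))"
        using step finF by (intro psubset_card_mono) (auto simp: A_def)
      then show ?thesis using Suc False by simp
    qed
  qed
  have "card (A n) \<le> n"
    using n card_mono[OF finF, of "A n"] by (auto simp: A_def)
  then have "A n = F" using grow[of n] by simp
  then show ?thesis by (auto simp: A_def)
qed

lemma (in group_hom) word_ball_image:
  assumes "S \<subseteq> carrier G"
  shows "word_ball H (h ` S) k = h ` word_ball G S k"
proof (induction k)
  case (Suc k)
  have "h (inv s \<otimes> t \<otimes> b) = inv\<^bsub>H\<^esub> h s \<otimes>\<^bsub>H\<^esub> h t \<otimes>\<^bsub>H\<^esub> h b"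
    if "s \<in> S" "t \<in> S" "b \<in> word_ball G S k" for s t b
    using that assms G.word_ball_subset[OF assms, of k] by (simp add: subset_iff)
  moreover have "h ` S \<times> h ` S \<times> h ` word_ball G S k =
      (\<lambda>(s, t, b). (h s, h t, h b)) ` (S \<times> S \<times> word_ball G S k)"
    by (auto simp: image_iff)
  ultimately have "(\<lambda>(s, t, b). inv\<^bsub>H\<^esub> s \<otimes>\<^bsub>H\<^esub> t \<otimes>\<^bsub>H\<^esub> b) ` (h ` S \<times> h ` S \<times> h ` word_ball G S k) =
      h ` (\<lambda>(s, t, b). inv s \<otimes> t \<otimes> b) ` (S \<times> S \<times> word_ball G S k)"
    unfolding image_image by (simp only: image_image) (auto intro!: image_cong)
  then show ?case using Suc by (simp add: image_Un)
qed simp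

text \<open>
  A Folner set of least size in \<open>H\<close>, translated on the right by the inverse of one of its elements, lies in
  the image of the ball, so it has a preimage inside the ball. Injectivity on the ball and on its product
  with \<open>S\<close> preserves both cardinalities in the Folner inequality.
\<close>

lemma (in group_hom) bounded_Folner_set_lift:
  assumes S: "finite S" "S \<subseteq> carrier G"
    and inj: "inj_on h (word_ball G S n \<union> (S <#> word_ball G S n))"
    and ex: "bounded_Folner_set H (h ` S) \<epsilon> n F0"
  obtains F where "bounded_Folner_set G S \<epsilon> n F"
proof -
  define E where "E = arg_min card (bounded_Folner_set H (h ` S) \<epsilon> n)"
  have E: "bounded_Folner_set H (h ` S) \<epsilon> n E"
    and min: "\<And>F'. bounded_Folner_set H (h ` S) \<epsilon> n F' \<Longrightarrow> card E \<le> card F'"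
    unfolding E_def
    using arg_min_natI[where P = "bounded_Folner_set H (h ` S) \<epsilon> n", OF ex]
      arg_min_nat_le[where P = "bounded_Folner_set H (h ` S) \<epsilon> n"] by blast+
  have finE: "finite E" and EH: "E \<subseteq> carrier H" and n: "card E \<le> n" and "E \<noteq> {}"
    and fol: "real (card ((h ` S) <#>\<^bsub>H\<^esub> E)) \<le> (1 + \<epsilon>) * real (card E)"
    using E by (auto simp: bounded_Folner_set_def)
  then obtain x where x: "x \<in> E" by blast
  have xH: "x \<in> carrier H" using x EH by auto
  let ?B = "word_ball G S n"
  have BG: "?B \<subseteq> carrier G" by (rule G.word_ball_subset[OF S(2)])
  have "h ` S \<subseteq> carrier H" using S by auto
  then have ball: "E \<subseteq> (h ` ?B) #>\<^bsub>H\<^esub> x"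
    using H.minimal_Folner_set_subset_ball[OF _ _ E min x] S(1)
    by (simp add: word_ball_image[OF S(2)])
  define F where "F = {b \<in> ?B. h b \<otimes>\<^bsub>H\<^esub> x \<in> E}"
  have FG: "F \<subseteq> carrier G" using BG by (auto simp: F_def)
  have finF: "finite F" using finite_word_ball[OF S(1), of G n] by (simp add: F_def)
  have "bij_betw (\<lambda>b. h b \<otimes>\<^bsub>H\<^esub> x) F E"
    unfolding bij_betw_def
  proof
    show "inj_on (\<lambda>b. h b \<otimes>\<^bsub>H\<^esub> x) F"
      using inj FG xH by (auto intro!: inj_onI simp: F_def subset_iff inj_on_def)
    show "(\<lambda>b. h b \<otimes>\<^bsub>H\<^esub> x) ` F = E"
      using ball by (auto simp: F_def r_coset_def image_iff)
  qed
  then have cardF: "card F = card E" by (rule bij_betw_same_card)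
  have "card (S <#> F) \<le> card ((h ` S) <#>\<^bsub>H\<^esub> E)"
  proof (rule card_inj_on_le)
    have SFG: "S <#> F \<subseteq> carrier G" using S FG by (rule_tac G.set_mult_closed) auto
    have "S <#> F \<subseteq> S <#> ?B" by (auto simp: set_mult_def F_def)
    then show "inj_on (\<lambda>g. h g \<otimes>\<^bsub>H\<^esub> x) (S <#> F)"
      using inj SFG xH by (auto intro!: inj_onI simp: subset_iff inj_on_def)
    show "(\<lambda>g. h g \<otimes>\<^bsub>H\<^esub> x) ` (S <#> F) \<subseteq> (h ` S) <#>\<^bsub>H\<^esub> E"
    proof clarify
      fix g assume "g \<in> S <#> F"
      then obtain s b where sb: "s \<in> S" "b \<in> F" "g = s \<otimes> b" by (auto simp: set_mult_def)
      then have "h g \<otimes>\<^bsub>H\<^esub> x = h s \<otimes>\<^bsub>H\<^esub> (h b \<otimes>\<^bsub>H\<^esub> x)"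
        using S FG xH by (simp add: H.m_assoc subset_iff)
      then show "h g \<otimes>\<^bsub>H\<^esub> x \<in> (h ` S) <#>\<^bsub>H\<^esub> E"
        using sb by (auto simp: set_mult_def F_def)
    qed
    show "finite ((h ` S) <#>\<^bsub>H\<^esub> E)" using S finE by (simp add: finite_set_mult)
  qed
  then have "bounded_Folner_set G S \<epsilon> n F"
    using fol cardF finF FG n \<open>E \<noteq> {}\<close> finE unfolding bounded_Folner_set_def by auto
  then show ?thesis by (rule that)
qed

section \<open>Normal subgroups of finite index\<close>

lemma (in group) rcoset_Int:
  assumes "M \<subseteq> carrier G" "N \<subseteq> carrier G" "g \<in> carrier G"
  shows "(M \<inter> N) #> g = (M #> g) \<inter> (N #> g)"
  using assms by (auto simp: r_coset_def subset_iff)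

lemma (in group) finite_index_normal_Int:
  assumes M: "M \<in> finite_index_normal G" and N: "N \<in> finite_index_normal G"
  shows "M \<inter> N \<in> finite_index_normal G"
proof -
  have nrm: "M \<lhd> G" "N \<lhd> G" and fin: "finite (rcosets M)" "finite (rcosets N)"
    using assms by (auto simp: finite_index_normal_def)
  have sub: "M \<subseteq> carrier G" "N \<subseteq> carrier G"
    using nrm by (auto dest: normal_imp_subgroup subgroup.subset)
  have "(rcosets (M \<inter> N)) \<subseteq> (\<lambda>(C, D). C \<inter> D) ` ((rcosets M) \<times> (rcosets N))"
    using sub by (force simp: RCOSETS_def rcoset_Int)
  then have "finite (rcosets (M \<inter> N))"
    using fin by (auto intro: finite_subset)
  then show ?thesis
    using nrm by (simp add: finite_index_normal_def normal_subgroup_intersect)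
qed

lemma (in group) carrier_finite_index_normal: "carrier G \<in> finite_index_normal G"
proof -
  have "carrier G #> g = carrier G" if "g \<in> carrier G" for g
    using that by (simp add: coset_join2 subgroup_self)
  then have "rcosets (carrier G) \<subseteq> {carrier G}" by (auto simp: RCOSETS_def)
  then have "finite (rcosets (carrier G))" by (rule finite_subset) simp
  moreover have "carrier G \<lhd> G" 
    by (rule normal_invI) (auto simp: subgroup_self)
  ultimately show ?thesis by (simp add: finite_index_normal_def)
qed

lemma (in group) finite_index_normal_directed:
  assumes "finite J" "J \<subseteq> finite_index_normal G"
  obtains N where "N \<in> finite_index_normal G" "\<forall>M\<in>J. N \<subseteq> M"
proof -
  have "\<exists>N\<in>finite_index_normal G. \<forall>M\<in>J. N \<subseteq> M"
    using assms
  proof (induction J rule: finite_induct)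
    case empty
    then show ?case using carrier_finite_index_normal by auto
  next
    case (insert M J)
    then obtain N where "N \<in> finite_index_normal G" "\<forall>M\<in>J. N \<subseteq> M" by auto
    then show ?case
      using insert.prems finite_index_normal_Int[of M N] by (intro bexI[of _ "M \<inter> N"]) auto
  qed
  then show ?thesis using that by blast
qed

text \<open>
  For each pair \<open>x \<noteq> y\<close> in \<open>X\<close> there is a normal subgroup of finite index that does not contain \<open>x \<otimes> inv y\<close>;
  a common lower bound of these finitely many subgroups separates all of \<open>X\<close>.
\<close>

lemma (in group) residually_finite_separates:
  assumes rf: "residually_finite G" and X: "finite X" "X \<subseteq> carrier G"
  obtains N where "N \<in> finite_index_normal G" "inj_on (\<lambda>g. N #> g) X"
proof -
  define P where "P = {(x, y) \<in> X \<times> X. x \<noteq> y}"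
  have "P \<subseteq> X \<times> X" by (auto simp: P_def)
  then have finP: "finite P" using X(1) by (metis finite_SigmaI finite_subset)
  have sep: "\<exists>N. N \<in> finite_index_normal G \<and> fst p \<otimes> inv (snd p) \<notin> N" if pP: "p \<in> P" for p
  proof -
    obtain x y where p: "p = (x, y)" and xy: "x \<in> carrier G" "y \<in> carrier G" "x \<noteq> y"
      using pP X(2) unfolding P_def by blast
    have "x \<otimes> inv y \<noteq> \<one>"
      using inv_equality[of x "inv y"] xy by fastforce
    moreover have "x \<otimes> inv y \<in> carrier G" using xy by simp
    ultimately show ?thesis using rf unfolding residually_finite_def p fst_conv snd_conv by blast
  qed
  have "\<exists>f. \<forall>p\<in>P. f p \<in> finite_index_normal G \<and> fst p \<otimes> inv (snd p) \<notin> f p"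
    by (rule bchoice, rule ballI, rule sep)
  then obtain f where f: "\<forall>p\<in>P. f p \<in> finite_index_normal G \<and> fst p \<otimes> inv (snd p) \<notin> f p"
    by (rule exE)
  have "finite (f ` P)" "f ` P \<subseteq> finite_index_normal G" using finP f by auto
  then obtain N where N: "N \<in> finite_index_normal G" and sub: "\<forall>M\<in>f ` P. N \<subseteq> M"
    by (rule finite_index_normal_directed)
  have NG: "subgroup N G"
    using N by (auto simp: finite_index_normal_def intro: normal_imp_subgroup)
  have "inj_on (\<lambda>g. N #> g) X"
  proof (rule inj_onI, rule ccontr)
    fix x y assume xy: "x \<in> X" "y \<in> X" "N #> x = N #> y" "x \<noteq> y"
    then have carr: "x \<in> carrier G" "y \<in> carrier G" using X(2) by blast+
    have "x \<in> N #> y" using rcos_self[OF carr(1) NG] xy(3) by simp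
    then have "x \<otimes> inv y \<in> N"
      by (rule subgroup.rcos_module_imp[OF NG is_group carr(2)])
    moreover have "(x, y) \<in> P" using xy by (simp add: P_def)
    ultimately show False using f sub by fastforce
  qed
  with N show ?thesis by (rule that)
qed

section \<open>Groups inside their profinite completions\<close>

definition to_completion :: "('a, 'm) monoid_scheme \<Rightarrow> 'a \<Rightarrow> 'a set \<Rightarrow> 'a set" where
  "to_completion G g = (\<lambda>N\<in>finite_index_normal G. N #>\<^bsub>G\<^esub> g)"

lemma (in group) finite_index_normalD:
  assumes "N \<in> finite_index_normal G"
  shows "N \<lhd> G" "subgroup N G"
  using assms by (auto simp: finite_index_normal_def intro: normal_imp_subgroup)

lemma carrier_profinite_completion:
  "carrier (profinite_completion G) = profinite_completion_set G"
  by (simp add: profinite_completion_def)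

lemma mult_profinite_completion:
  "N \<in> finite_index_normal G \<Longrightarrow>
     (x \<otimes>\<^bsub>profinite_completion G\<^esub> y) N = x N \<otimes>\<^bsub>G Mod N\<^esub> y N"
  by (simp add: profinite_completion_def)

lemma (in group) to_completion_closed:
  assumes "g \<in> carrier G"
  shows "to_completion G g \<in> profinite_completion_set G"
  using assms finite_index_normalD
  by (auto simp: to_completion_def profinite_completion_set_def carrier_FactGroup
      transition_map_rcoset)

lemma (in group) to_completion_hom: "to_completion G \<in> hom G (profinite_completion G)"
proof (rule homI)
  fix x assume "x \<in> carrier G"
  then show "to_completion G x \<in> carrier (profinite_completion G)"
    by (simp add: carrier_profinite_completion to_completion_closed)
next
  fix x y assume "x \<in> carrier G" "y \<in> carrier G"
  then show "to_completion G (x \<otimes> y) =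
      to_completion G x \<otimes>\<^bsub>profinite_completion G\<^esub> to_completion G y"
    by (auto simp: to_completion_def profinite_completion_def normal.rcos_sum
        finite_index_normalD fun_eq_iff)
qed

text \<open>
  A basic open set constrains only finitely many coordinates. All of them are determined by the coordinate
  at one \<open>N\<close> contained in the subgroups concerned, and that coordinate is a coset \<open>N #> g\<close>.
\<close>

lemma (in group) to_completion_dense:
  assumes U: "openin (profinite_completion_topology G) U" and x: "x \<in> U"
  obtains g where "g \<in> carrier G" "to_completion G g \<in> U"
proof -
  let ?I = "finite_index_normal G" and ?D = "\<lambda>N. discrete_topology (carrier (G Mod N))"
  obtain T where T: "openin (product_topology ?D ?I) T" and UT: "U = T \<inter> profinite_completion_set G"
    using U unfolding profinite_completion_topology_def openin_subtopology by blast
  have xT: "x \<in> T" using x UT by blast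
  obtain V where V: "finite {N \<in> ?I. V N \<noteq> topspace (?D N)}" "x \<in> Pi\<^sub>E ?I V" "Pi\<^sub>E ?I V \<subseteq> T"
    using bspec[OF T[unfolded openin_product_topology_alt] xT]
    by (elim exE conjE) (rule that)
  obtain N where N: "N \<in> ?I" and sub: "\<forall>M\<in>{N \<in> ?I. V N \<noteq> topspace (?D N)}. N \<subseteq> M"
    by (rule finite_index_normal_directed[OF V(1)]) auto
  have xc: "x \<in> profinite_completion_set G" using x UT by simp
  then have "x N \<in> carrier (G Mod N)" using N unfolding profinite_completion_set_def by blast
  then obtain g where g: "g \<in> carrier G" "x N = N #> g" by (auto simp: carrier_FactGroup)
  have "to_completion G g M \<in> V M" if M: "M \<in> ?I" for M
  proof (cases "V M = topspace (?D M)")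
    case True
    then show ?thesis using M g by (auto simp: to_completion_def carrier_FactGroup)
  next
    case False
    then have "N \<subseteq> M" using sub M by blast
    then have "x M = M <#> x N" using xc M N unfolding profinite_completion_set_def by blast
    also have "\<dots> = M #> g"
      by (simp add: g transition_map_rcoset \<open>N \<subseteq> M\<close> M N finite_index_normalD)
    finally show ?thesis using PiE_mem[OF V(2) M] M by (simp add: to_completion_def)
  qed
  then have "to_completion G g \<in> Pi\<^sub>E ?I V" by (auto simp: to_completion_def)
  then show ?thesis using that[OF g(1)] V(3) UT to_completion_closed[OF g(1)] by blast
qed

lemma continuous_map_completion_coordinate:
  assumes "N \<in> finite_index_normal G"
  shows "continuous_map (profinite_completion_topology G)
           (discrete_topology (carrier (G Mod N))) (\<lambda>x. x N)"
  unfolding profinite_completion_topology_def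
  by (intro continuous_map_from_subtopology continuous_map_product_coordinates assms)

text \<open>
  The homomorphism is the composition of the canonical map of \<open>G\<close> into its completion, the isomorphism of
  completions and the projection to the coordinate \<open>N\<close>. The fibers of the last two maps together are
  nonempty and open, so by density each of them contains an element of \<open>G\<close>.
\<close>

lemma surjective_hom_to_finite_quotient:
  assumes G: "group G" and H: "group H"
    and iso: "isomorphic_profinite_completions G H" and N: "N \<in> finite_index_normal H"
  obtains \<phi> where "\<phi> \<in> hom G (H Mod N)" "\<phi> ` carrier G = carrier (H Mod N)"
proof -
  interpret G: group G by fact
  interpret H: group H by fact
  obtain f where fi: "f \<in> iso (profinite_completion G) (profinite_completion H)"
    and fh: "homeomorphic_map (profinite_completion_topology G) (profinite_completion_topology H) f"
    using iso unfolding isomorphic_profinite_completions_def by blast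
  define \<phi> where "\<phi> g = f (to_completion G g) N" for g
  have f_hom: "f \<in> hom (profinite_completion G) (profinite_completion H)"
    and f_surj: "f ` carrier (profinite_completion G) = carrier (profinite_completion H)"
    using fi by (auto simp: iso_iff)
  have "x N \<in> carrier (H Mod N)" if "x \<in> carrier (profinite_completion H)" for x
    using that N unfolding carrier_profinite_completion profinite_completion_set_def by blast
  then have "(\<lambda>x. x N) \<in> hom (profinite_completion H) (H Mod N)"
    by (intro homI) (simp_all add: mult_profinite_completion[OF N])
  then have "(\<lambda>x. x N) \<circ> (f \<circ> to_completion G) \<in> hom G (H Mod N)"
    by (intro hom_compose[OF hom_compose[OF G.to_completion_hom f_hom]])
  then have hom: "\<phi> \<in> hom G (H Mod N)" by (simp add: \<phi>_def[abs_def] comp_def)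
  moreover have "\<phi> ` carrier G = carrier (H Mod N)"
  proof
    show "\<phi> ` carrier G \<subseteq> carrier (H Mod N)" using hom by (auto simp: hom_def)
    show "carrier (H Mod N) \<subseteq> \<phi> ` carrier G"
    proof
      fix C assume C: "C \<in> carrier (H Mod N)"
      then obtain c where c: "c \<in> carrier H" "C = N #>\<^bsub>H\<^esub> c" by (auto simp: carrier_FactGroup)
      have "to_completion H c \<in> f ` carrier (profinite_completion G)"
        unfolding f_surj unfolding carrier_profinite_completion using c(1) by (rule H.to_completion_closed)
      then obtain x where x: "to_completion H c = f x" "x \<in> carrier (profinite_completion G)"
        by (rule imageE)
      let ?U = "{y \<in> topspace (profinite_completion_topology G). f y N \<in> {C}}"
      have "continuous_map (profinite_completion_topology G)
              (discrete_topology (carrier (H Mod N))) ((\<lambda>x. x N) \<circ> f)"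
        by (rule continuous_map_compose[OF homeomorphic_imp_continuous_map[OF fh]
              continuous_map_completion_coordinate[OF N]])
      from openin_continuous_map_preimage[OF this, of "{C}"]
      have "openin (profinite_completion_topology G) ?U"
        using C by simp
      moreover have "x \<in> ?U"
        using x(2) c(2) N
        by (simp add: topspace_profinite_completion_topology to_completion_def flip: x(1))
      ultimately obtain g where "g \<in> carrier G" "to_completion G g \<in> ?U"
        by (rule G.to_completion_dense)
      then show "C \<in> \<phi> ` carrier G" by (auto simp: \<phi>_def)
    qed
  qed
  ultimately show ?thesis by (rule that)
qed

lemma isomorphic_profinite_completions_sym:
  assumes G: "group G" and iso: "isomorphic_profinite_completions G H"
  shows "isomorphic_profinite_completions H G"
proof -
  interpret C: group "profinite_completion G" by (rule group.group_profinite_completion[OF G])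
  obtain f where fi: "f \<in> iso (profinite_completion G) (profinite_completion H)"
    and fh: "homeomorphic_map (profinite_completion_topology G) (profinite_completion_topology H) f"
    using iso unfolding isomorphic_profinite_completions_def by blast
  let ?g = "inv_into (carrier (profinite_completion G)) f"
  obtain g where g: "homeomorphic_maps (profinite_completion_topology G)
      (profinite_completion_topology H) f g"
    using fh homeomorphic_map_maps by blast
  have inj: "inj_on f (carrier (profinite_completion G))"
    and im: "f ` carrier (profinite_completion G) = carrier (profinite_completion H)"
    using fi by (auto simp: iso_iff)
  have "?g y = g y" if y: "y \<in> carrier (profinite_completion H)" for y
  proof -
    obtain x where "x \<in> carrier (profinite_completion G)" "y = f x" 
      using im y by blast
    then show ?thesis
      using g inj by (simp add: homeomorphic_maps_def topspace_profinite_completion_topology)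
  qed
  then have "homeomorphic_map (profinite_completion_topology H) (profinite_completion_topology G) ?g"
    using homeomorphic_map_eq[of "profinite_completion_topology H" "profinite_completion_topology G" g ?g]
      g by (simp add: homeomorphic_maps_map topspace_profinite_completion_topology)
  then show ?thesis
    using C.iso_set_sym[OF fi] unfolding isomorphic_profinite_completions_def by blast
qed

section \<open>Uniform amenability and finite quotients\<close>

text \<open>
  The quotient of \<open>H\<close> is chosen to be injective not only on the ball and its product with \<open>S\<close>, as the lift
  requires, but also on \<open>S\<close>: the bound \<open>m\<close> depends on the size of the subset, so \<open>S\<close> and its counterpart
  \<open>S'\<close> in \<open>G\<close> must have equally many elements.
\<close>

lemma uniformly_amenable_transfer:
  assumes G: "group G" and H: "group H" and rf: "residually_finite H"
    and iso: "isomorphic_profinite_completions G H" and ua: "uniformly_amenable G"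
  shows "uniformly_amenable H"
proof -
  interpret H: group H by fact
  obtain m where m: "\<forall>\<epsilon>>0. \<forall>S. finite S \<and> S \<subseteq> carrier G \<longrightarrow>
      (\<exists>F. bounded_Folner_set G S \<epsilon> (m \<epsilon> (card S)) F)"
    using ua unfolding uniformly_amenable_iff ..
  have "\<exists>F. bounded_Folner_set H S \<epsilon> (m \<epsilon> (card S)) F"
    if \<epsilon>: "\<epsilon> > 0" and S: "finite S" "S \<subseteq> carrier H" for \<epsilon> S
  proof -
    let ?n = "m \<epsilon> (card S)"
    let ?B = "word_ball H S ?n"
    let ?X = "S \<union> (?B \<union> (S <#>\<^bsub>H\<^esub> ?B))"
    have BH: "?B \<subseteq> carrier H" by (rule H.word_ball_subset[OF S(2)])
    have "finite ?X"
      using S(1) by (simp add: finite_word_ball finite_set_mult)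
    moreover have "?X \<subseteq> carrier H"
      using S(2) BH H.set_mult_closed[OF S(2) BH] by simp
    ultimately obtain N where N: "N \<in> finite_index_normal H" and inj: "inj_on (\<lambda>g. N #>\<^bsub>H\<^esub> g) ?X"
      by (rule H.residually_finite_separates[OF rf])
    let ?\<pi> = "\<lambda>g. N #>\<^bsub>H\<^esub> g"
    interpret N: normal N H by (rule H.finite_index_normalD[OF N])
    interpret \<pi>: group_hom H "H Mod N" ?\<pi>
      by (simp add: group_hom_def group_hom_axioms_def H N.factorgroup_is_group N.r_coset_hom_Mod)
    obtain \<phi> where \<phi>: "\<phi> \<in> hom G (H Mod N)" "\<phi> ` carrier G = carrier (H Mod N)"
      using surjective_hom_to_finite_quotient[OF G H iso N] .
    interpret \<phi>: group_hom G "H Mod N" \<phi>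
      by (simp add: group_hom_def group_hom_axioms_def G N.factorgroup_is_group \<phi>)
    have "?\<pi> ` S \<subseteq> \<phi> ` carrier G"
      unfolding \<phi>(2) carrier_FactGroup using S(2) by (rule image_mono)
    then obtain S' where S': "S' \<subseteq> carrier G" "inj_on \<phi> S'" "?\<pi> ` S = \<phi> ` S'"
      unfolding subset_image_inj by blast
    have "finite (\<phi> ` S')" using S(1) unfolding S'(3)[symmetric] by (rule finite_imageI)
    then have finS': "finite S'" using S'(2) by (rule finite_imageD)
    have "card S' = card (\<phi> ` S')" using S'(2) by (simp add: card_image)
    also have "\<dots> = card S"
      unfolding S'(3)[symmetric] by (rule card_image[OF inj_on_subset[OF inj Un_upper1]])
    finally have "\<exists>F. bounded_Folner_set G S' \<epsilon> ?n F"
      using m \<epsilon> finS' S'(1) by metis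
    then obtain F where "bounded_Folner_set G S' \<epsilon> ?n F" ..
    then obtain F' where "bounded_Folner_set (H Mod N) (\<phi> ` S') \<epsilon> ?n F'"
      by (rule \<phi>.bounded_Folner_set_image[OF finS' S'(1)])
    then have "bounded_Folner_set (H Mod N) (?\<pi> ` S) \<epsilon> ?n F'"
      unfolding S'(3) .
    then obtain F'' where "bounded_Folner_set H S \<epsilon> ?n F''"
      by (rule \<pi>.bounded_Folner_set_lift[OF S inj_on_subset[OF inj Un_upper2]])
    then show ?thesis ..
  qed
  then show ?thesis unfolding uniformly_amenable_iff by (intro exI[of _ m]) simp
qed

theorem theorem1p2:
  fixes G1 :: "('a, 'm) monoid_scheme" and G2 :: "('b, 'n) monoid_scheme"
  assumes "group G1" and "group G2"
    and "residually_finite G1" and "residually_finite G2"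
    and "isomorphic_profinite_completions G1 G2"
  shows "uniformly_amenable G1 \<longleftrightarrow> uniformly_amenable G2"
  using uniformly_amenable_transfer isomorphic_profinite_completions_sym assms by metis

end
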